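(* Let $(\Omega,\rho)$ be a Euclidean polynomial space (with inner product $\langle\cdot,\cdot\rangle$ on $\mathrm{Pol}(\Omega)$) of dimension $n$, and let $X\subset\Omega$ be a weighted $t$-design in $(\Omega,\rho)$ with weight function $w:X\to\mathbb{R}_{>0}$. Let $m\ge n$ and let $\tau:\Omega\to\mathbb{R}^m$ be an injection that is affinely compatible with $\rho$. Let $\xi:\mathbb{R}^m\to\mathbb{R}^s$ be an affine map (not necessarily injective, not necessarily related to $\rho$). Then for each $f\in\mathbb{R}_t[x_1,\ldots,x_s]$ we have $f\circ\xi\circ\tau\in\mathrm{Pol}(\Omega,t)$ and \[ \langle 1, f\circ\xi\circ\tau\rangle=\sum_{x\in X}w(x)\,f(\xi(\tau(x))). \]
   Context: Let $\Omega$ be a nonempty set and $\rho:\Omega\times\Omega\to\mathbb{R}$ a function (the separation function); for $a\in\Omega$ write $\rho_a(\eta)=\rho(a,\eta)$. Let $\mathrm{Pol}(\Omega,0)$ be the space of constant real functions on $\Omega$, $\mathrm{Pol}(\Omega,1)=\mathrm{Span}_{\mathbb{R}}\{f\circ\rho_a : a\in\Omega,\ f\in\mathbb{R}[x],\ \deg f\le 1\}$, and inductively $\mathrm{Pol}(\Omega,r+1)=\mathrm{Span}_{\mathbb{R}}\{gh : g\in\mathrm{Pol}(\Omega,r),\ h\in\mathrm{Pol}(\Omega,1)\}$; $\mathrm{Pol}(\Omega)=\bigcup_{r\ge0}\mathrm{Pol}(\Omega,r)$. $(\Omega,\rho)$ together with an inner product $\langle\cdot,\cdot\rangle$ on $\mathrm{Pol}(\Omega)$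 is a polynomial space if: (i) $\rho(x,y)=\rho(y,x)$ for all $x,y$; (ii) each $\mathrm{Pol}(\Omega,r)$ is finite-dimensional; (iii) $\langle f,g\rangle=\langle 1,fg\rangle$ for all $f,g\in\mathrm{Pol}(\Omega)$; (iv) if $f\in\mathrm{Pol}(\Omega)$ satisfies $f(x)\ge0$ for all $x$, then $\langle 1,f\rangle\ge 0$, with equality iff $f=0$. We normalize $\langle1,1\rangle=1$. The dimension of the polynomial space is $\dim\mathrm{Pol}(\Omega,1)-1$. Two separation functions $\rho,\sigma$ are affinely equivalent if $\rho=a\sigma+b$ for some $a\in\mathbb{R}\setminus\{0\}$, $b\in\mathbb{R}$. The polynomial space is Euclidean if there exist an integer $d$, an injection $\tau_0:\Omega\to\mathbb{R}^d$ and a separation function $\rho'$ affinely equivalent to $\rho$ with $\rho'(x,y)=(\tau_0(x),\tau_0(y))$ for all $x,y$, where $(\cdot,\cdot)$ is the standard inner product. An injection $\tau:\Omega\to\mathbb{R}^m$ is affinely compatible with $\rho$ if there exist $a\in\mathbb{R}\setminus\{0\}$, $b\in\mathbb{R}$ with $\rho(x,y)=a(\tau(x),\tau(y))+b$ for all $x,y\in\Omega$. A weighted $t$-design is a finite subset $X\subset\Omega$ with a weight function $w:X\to\mathbb{R}_{>0}$ such that $\langle 1,f\rangle=\sum_{x\in X}w(x)f(x)$ for all $f\in\mathrm{Pol}(\Omega,t)$. $\mathbb{R}_t[x_1,\ldots,x_s]$ is the space of real polynomials of total degree at most $t$. *)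

theory Defs
  imports
    "Jordan_Normal_Form.Matrix"
    "HOL-Library.Function_Algebras"
    "HOL-Library.Poly_Mapping"
    "HOL-Computational_Algebra.Polynomial"
begin

text \<open>The set \<open>\<Omega>\<close> is the (nonempty) type \<open>'a\<close>. Sums, products, \<open>0\<close> and \<open>1\<close> of real functions
  on it are pointwise. The space \<open>\<real>\<^sup>d\<close> is \<open>carrier_vec d :: real vec set\<close>, with \<open>\<bullet>\<close> the
  standard inner product.\<close>

interpretation real_fun: vector_space "\<lambda>(c::real) (f::'a \<Rightarrow> real) x. c * f x"
  by unfold_locales (auto simp: fun_eq_iff algebra_simps)

fun Pol :: "('a \<Rightarrow> 'a \<Rightarrow> real) \<Rightarrow> nat \<Rightarrow> ('a \<Rightarrow> real) set" where
  "Pol \<rho> 0 = range (\<lambda>c x. c)"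
| "Pol \<rho> (Suc 0) = real_fun.span {poly f \<circ> \<rho> a | f a. degree f \<le> 1}"
| "Pol \<rho> (Suc (Suc r)) = real_fun.span {g * h | g h. g \<in> Pol \<rho> (Suc r) \<and> h \<in> Pol \<rho> (Suc 0)}"

definition Pol_all :: "('a \<Rightarrow> 'a \<Rightarrow> real) \<Rightarrow> ('a \<Rightarrow> real) set" where
  "Pol_all \<rho> = (\<Union>r. Pol \<rho> r)"

definition inner_product_on ::
    "('a \<Rightarrow> real) set \<Rightarrow> (('a \<Rightarrow> real) \<Rightarrow> ('a \<Rightarrow> real) \<Rightarrow> real) \<Rightarrow> bool" where
  "inner_product_on V ip \<longleftrightarrow>
     (\<forall>f\<in>V. \<forall>g\<in>V. ip f g = ip g f) \<and>
     (\<forall>f\<in>V. \<forall>g\<in>V. \<forall>h\<in>V. ip (f + g) h = ip f h + ip g h) \<and>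
     (\<forall>c. \<forall>f\<in>V. \<forall>g\<in>V. ip (\<lambda>x. c * f x) g = c * ip f g) \<and>
     (\<forall>f\<in>V. 0 \<le> ip f f \<and> (ip f f = 0 \<longleftrightarrow> f = 0))"

locale polynomial_space =
  fixes \<rho> :: "'a \<Rightarrow> 'a \<Rightarrow> real"
    and ip :: "('a \<Rightarrow> real) \<Rightarrow> ('a \<Rightarrow> real) \<Rightarrow> real"
  assumes inner_product: "inner_product_on (Pol_all \<rho>) ip"
    and symmetric: "\<rho> x y = \<rho> y x"
    and finite_dim: "\<exists>B. finite B \<and> Pol \<rho> r = real_fun.span B"
    and ip_mult: "f \<in> Pol_all \<rho> \<Longrightarrow> g \<in> Pol_all \<rho> \<Longrightarrow> ip f g = ip 1 (f * g)"
    and ip_nonneg: "f \<in> Pol_all \<rho> \<Longrightarrow> (\<And>x. 0 \<le> f x) \<Longrightarrow> 0 \<le> ip 1 f"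
    and ip_eq_0_iff: "f \<in> Pol_all \<rho> \<Longrightarrow> (\<And>x. 0 \<le> f x) \<Longrightarrow> ip 1 f = 0 \<longleftrightarrow> f = 0"
    and normalized: "ip 1 1 = 1"

text \<open>The subtraction does not truncate: \<open>Pol \<rho> 1\<close> contains the constant \<open>1\<close>.\<close>

definition polynomial_space_dim :: "('a \<Rightarrow> 'a \<Rightarrow> real) \<Rightarrow> nat" where
  "polynomial_space_dim \<rho> = real_fun.dim (Pol \<rho> 1) - 1"

definition affinely_equivalent :: "('a \<Rightarrow> 'a \<Rightarrow> real) \<Rightarrow> ('a \<Rightarrow> 'a \<Rightarrow> real) \<Rightarrow> bool" where
  "affinely_equivalent \<rho> \<sigma> \<longleftrightarrow> (\<exists>a b. a \<noteq> 0 \<and> (\<forall>x y. \<rho> x y = a * \<sigma> x y + b))"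

definition euclidean_polynomial_space ::
    "('a \<Rightarrow> 'a \<Rightarrow> real) \<Rightarrow> (('a \<Rightarrow> real) \<Rightarrow> ('a \<Rightarrow> real) \<Rightarrow> real) \<Rightarrow> bool" where
  "euclidean_polynomial_space \<rho> ip \<longleftrightarrow>
     polynomial_space \<rho> ip \<and>
     (\<exists>d \<tau>\<^sub>0 \<rho>'. range \<tau>\<^sub>0 \<subseteq> carrier_vec d \<and> inj \<tau>\<^sub>0 \<and> affinely_equivalent \<rho>' \<rho> \<and>
        (\<forall>x y. \<rho>' x y = \<tau>\<^sub>0 x \<bullet> \<tau>\<^sub>0 y))"

definition affinely_compatible ::
    "nat \<Rightarrow> ('a \<Rightarrow> real vec) \<Rightarrow> ('a \<Rightarrow> 'a \<Rightarrow> real) \<Rightarrow> bool" where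
  "affinely_compatible m \<tau> \<rho> \<longleftrightarrow>
     range \<tau> \<subseteq> carrier_vec m \<and> inj \<tau> \<and>
     (\<exists>a b. a \<noteq> 0 \<and> (\<forall>x y. \<rho> x y = a * (\<tau> x \<bullet> \<tau> y) + b))"

definition weighted_design ::
    "('a \<Rightarrow> 'a \<Rightarrow> real) \<Rightarrow> (('a \<Rightarrow> real) \<Rightarrow> ('a \<Rightarrow> real) \<Rightarrow> real) \<Rightarrow> nat \<Rightarrow> 'a set \<Rightarrow> ('a \<Rightarrow> real) \<Rightarrow> bool"
  where
  "weighted_design \<rho> ip t X w \<longleftrightarrow>
     finite X \<and> (\<forall>x\<in>X. 0 < w x) \<and> (\<forall>f\<in>Pol \<rho> t. ip 1 f = (\<Sum>x\<in>X. w x * f x))"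

definition affine_map :: "nat \<Rightarrow> nat \<Rightarrow> (real vec \<Rightarrow> real vec) \<Rightarrow> bool" where
  "affine_map m s \<xi> \<longleftrightarrow>
     (\<exists>A\<in>carrier_mat s m. \<exists>c\<in>carrier_vec s. \<forall>v\<in>carrier_vec m. \<xi> v = A *\<^sub>v v + c)"

text \<open>A multivariate polynomial maps finitely many monomials, given as exponent functions
  \<open>nat \<Rightarrow>\<^sub>0 nat\<close>, to nonzero coefficients. The variables \<open>x\<^sub>1, \<dots>, x\<^sub>s\<close> are indexed
  by \<open>0, \<dots>, s - 1\<close>.\<close>

type_synonym real_mpoly = "(nat \<Rightarrow>\<^sub>0 nat) \<Rightarrow>\<^sub>0 real"

definition mpoly_eval :: "real_mpoly \<Rightarrow> real vec \<Rightarrow> real" where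
  "mpoly_eval p v =
     (\<Sum>\<alpha>\<in>Poly_Mapping.keys p.
        Poly_Mapping.lookup p \<alpha> *
        (\<Prod>i\<in>Poly_Mapping.keys \<alpha>. (v $ i) ^ Poly_Mapping.lookup \<alpha> i))"

definition mpolys_upto :: "nat \<Rightarrow> nat \<Rightarrow> real_mpoly set" where
  "mpolys_upto s t =
     {p. \<forall>\<alpha>\<in>Poly_Mapping.keys p.
           Poly_Mapping.keys \<alpha> \<subseteq> {..<s} \<and>
           (\<Sum>i\<in>Poly_Mapping.keys \<alpha>. Poly_Mapping.lookup \<alpha> i) \<le> t}"

end

theory Submission
  imports Defs
begin

text \<open>The heart of the matter is that the coordinates of \<open>\<tau>\<close> lie in \<open>Pol \<rho> 1\<close>. Up to affine
  equivalence \<open>\<rho>\<close> is the kernel \<open>(a, x) \<mapsto> \<Sum>\<^sub>i \<tau>\<^sub>i(a) \<tau>\<^sub>i(x)\<close>. A linear functional \<open>\<phi>\<close> that vanishes on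
  all sections of this kernel satisfies \<open>\<Sum>\<^sub>i \<phi>(\<tau>\<^sub>i) \<tau>\<^sub>i = 0\<close>; applying \<open>\<phi>\<close> once more gives
  \<open>\<Sum>\<^sub>i \<phi>(\<tau>\<^sub>i)\<^sup>2 = 0\<close>, so \<open>\<phi>\<close> vanishes on every \<open>\<tau>\<^sub>i\<close>. Hence the \<open>\<tau>\<^sub>i\<close> are in the span of the
  sections. Since the spaces \<open>Pol \<rho> r\<close> multiply like a filtered algebra containing the constants, a
  polynomial of degree at most \<open>t\<close> in affine combinations of the \<open>\<tau>\<^sub>i\<close> lies in \<open>Pol \<rho> t\<close>, where the
  design property applies.\<close>

lemma sum_fun_eq: "sum f I = (\<lambda>x. \<Sum>i\<in>I. f i x)"
  for f :: "'i \<Rightarrow> 'a \<Rightarrow> 'b::comm_monoid_add"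
  by (induction I rule: infinite_finite_induct) (auto simp: fun_eq_iff)

lemma (in vector_space) exists_functional_separating_span:
  assumes "x \<notin> span S"
  obtains \<phi> where "Vector_Spaces.linear scale (*) \<phi>" "\<And>y. y \<in> S \<Longrightarrow> \<phi> y = 0" "\<phi> x = 1"
proof -
  obtain B where B: "B \<subseteq> S" "independent B" "S \<subseteq> span B"
    using maximal_independent_subset by blast
  then have "x \<notin> span B"
    using assms span_mono by blast
  then have ind: "independent (insert x B)" and "x \<notin> B"
    using B(2) independent_insertI span_base by blast+
  define C where "C = extend_basis (insert x B)"
  have C: "independent C" "span C = UNIV" "insert x B \<subseteq> C"
    unfolding C_def
    using independent_extend_basis[OF ind] span_extend_basis[OF ind] extend_basis_superset[OF ind]
    by auto
  show thesis
  proof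
    show "Vector_Spaces.linear scale (*) (\<lambda>y. representation C y x)"
      using C by (intro linear_representation)
    show "representation C x x = 1"
      using C by (simp add: representation_basis)
    fix y assume "y \<in> S"
    then have "representation C y = representation B y"
      using B C by (intro representation_extend) auto
    then show "representation C y x = 0"
      using representation_ne_zero \<open>x \<notin> B\<close> by metis
  qed
qed

lemma feature_in_span_kernel_sections:
  fixes h :: "'i \<Rightarrow> 'a \<Rightarrow> real"
  assumes "finite I" "j \<in> I"
  shows "h j \<in> real_fun.span (range (\<lambda>a x. \<Sum>i\<in>I. h i a * h i x))"
    (is "_ \<in> real_fun.span ?sections")
proof (rule ccontr)
  assume "h j \<notin> real_fun.span ?sections"
  then obtain \<phi> where linear: "Vector_Spaces.linear (\<lambda>(c::real) f x. c * f x) (*) \<phi>"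
    and sections: "\<And>a. \<phi> (\<lambda>x. \<Sum>i\<in>I. h i a * h i x) = 0" and "\<phi> (h j) = 1"
    by (rule real_fun.exists_functional_separating_span) auto
  interpret \<phi>: Vector_Spaces.linear "\<lambda>(c::real) (f :: 'a \<Rightarrow> real) x. c * f x" "(*)" \<phi>
    by (fact linear)
  have combination: "\<phi> (\<lambda>x. \<Sum>i\<in>I. c i * h i x) = (\<Sum>i\<in>I. c i * \<phi> (h i))" for c
    using \<phi>.sum[of "\<lambda>i x. c i * h i x" I] by (simp add: sum_fun_eq \<phi>.scale)
  have "(\<Sum>i\<in>I. \<phi> (h i) * h i a) = 0" for a
    using sections[of a] by (simp add: combination mult.commute[of "\<phi> _"])
  then have "(\<Sum>i\<in>I. \<phi> (h i) * \<phi> (h i)) = 0"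
    using combination[of "\<lambda>i. \<phi> (h i)"] \<phi>.zero by (simp add: zero_fun_def)
  then have "\<phi> (h j) = 0"
    using assms by (simp add: sum_nonneg_eq_0_iff)
  with \<open>\<phi> (h j) = 1\<close> show False by simp
qed

declare Pol.simps(2,3) [simp del]

lemma subspace_Pol: "real_fun.subspace (Pol \<rho> r)"
proof (induction \<rho> r rule: Pol.induct)
  case (1 \<rho>)
  then show ?case
    by (auto simp: real_fun.subspace_def fun_eq_iff image_def)
qed (simp_all only: Pol.simps real_fun.subspace_span)

lemma Pol_add: "f \<in> Pol \<rho> r \<Longrightarrow> g \<in> Pol \<rho> r \<Longrightarrow> (\<lambda>x. f x + g x) \<in> Pol \<rho> r"
  using real_fun.subspace_add[OF subspace_Pol] by (simp add: plus_fun_def)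

lemma Pol_cmult: "f \<in> Pol \<rho> r \<Longrightarrow> (\<lambda>x. c * f x) \<in> Pol \<rho> r"
  by (rule real_fun.subspace_scale[OF subspace_Pol])

lemma Pol_sum: "(\<And>i. i \<in> I \<Longrightarrow> f i \<in> Pol \<rho> r) \<Longrightarrow> (\<lambda>x. \<Sum>i\<in>I. f i x) \<in> Pol \<rho> r"
  using real_fun.subspace_sum[OF subspace_Pol, of I f] by (simp add: sum_fun_eq)

lemma affine_separation_in_Pol_1: "(\<lambda>x. c * \<rho> a x + d) \<in> Pol \<rho> 1"
proof -
  have "(\<lambda>x. c * \<rho> a x + d) = poly [:d, c:] \<circ> \<rho> a"
    by (simp add: fun_eq_iff)
  moreover have "degree [:d, c:] \<le> 1"
    by simp
  ultimately show ?thesis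
    unfolding One_nat_def Pol.simps by (auto intro!: real_fun.span_base)
qed

lemma Pol_mult_Pol_1:
  assumes "f \<in> Pol \<rho> r" "g \<in> Pol \<rho> 1"
  shows "(\<lambda>x. f x * g x) \<in> Pol \<rho> (Suc r)"
proof (cases r)
  case 0
  with assms show ?thesis
    by (auto intro: Pol_cmult)
next
  case (Suc k)
  have "(\<lambda>x. f x * g x) = f * g"
    by (simp add: fun_eq_iff)
  with assms Suc show ?thesis
    by (auto simp: Pol.simps(3) intro!: real_fun.span_base)
qed

lemma Pol_mono:
  assumes "r \<le> s"
  shows "Pol \<rho> r \<subseteq> Pol \<rho> s"
proof (rule lift_Suc_mono_le[OF _ assms])
  show "Pol \<rho> k \<subseteq> Pol \<rho> (Suc k)" for k
    using Pol_mult_Pol_1[OF _ affine_separation_in_Pol_1[where c = 0 and d = 1]] by auto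
qed

lemma Pol_const: "(\<lambda>x. c) \<in> Pol \<rho> r"
  using Pol_mono[of 0 r \<rho>] by auto

lemma Pol_mult:
  assumes f: "f \<in> Pol \<rho> r" and "g \<in> Pol \<rho> s"
  shows "(\<lambda>x. f x * g x) \<in> Pol \<rho> (r + s)"
  using assms(2)
proof (induction s arbitrary: g rule: induct_nat_012)
  case 0
  then obtain c where "g = (\<lambda>x. c)"
    by auto
  with Pol_cmult[OF f, of c] show ?case
    by (simp add: mult.commute)
next
  case 1
  with Pol_mult_Pol_1[OF f] show ?case
    by simp
next
  case (ge2 k)
  from ge2.prems
  have "g \<in> real_fun.span {p * q | p q. p \<in> Pol \<rho> (Suc k) \<and> q \<in> Pol \<rho> 1}"
    by (simp add: Pol.simps(3))
  then show ?case
  proof (induction rule: real_fun.span_induct_alt)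
    case base
    then show ?case
      using Pol_const[of 0] by simp
  next
    case (step c g h)
    then obtain p q where g: "g = p * q" and p: "p \<in> Pol \<rho> (Suc k)" and q: "q \<in> Pol \<rho> 1"
      by blast
    have "(\<lambda>x. f x * p x * q x) \<in> Pol \<rho> (r + Suc (Suc k))"
      using Pol_mult_Pol_1[OF ge2.IH(2)[OF p] q] by simp
    then have "(\<lambda>x. c * (f x * p x * q x) + f x * h x) \<in> Pol \<rho> (r + Suc (Suc k))"
      using step by (intro Pol_add Pol_cmult)
    then show ?case
      by (simp add: g algebra_simps)
  qed
qed

lemma Pol_power: "f \<in> Pol \<rho> r \<Longrightarrow> (\<lambda>x. f x ^ k) \<in> Pol \<rho> (k * r)"
  by (induction k) (auto intro: Pol_const Pol_mult)

lemma Pol_prod: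
  assumes "\<And>i. i \<in> I \<Longrightarrow> f i \<in> Pol \<rho> (r i)"
  shows "(\<lambda>x. \<Prod>i\<in>I. f i x) \<in> Pol \<rho> (\<Sum>i\<in>I. r i)"
  using assms
  by (induction I rule: infinite_finite_induct) (auto intro: Pol_const Pol_mult)

lemma mpoly_eval_in_Pol:
  assumes f: "f \<in> mpolys_upto s t"
    and coordinates: "\<And>i. i < s \<Longrightarrow> (\<lambda>x. \<phi> x $ i) \<in> Pol \<rho> r"
  shows "(\<lambda>x. mpoly_eval f (\<phi> x)) \<in> Pol \<rho> (t * r)"
  unfolding mpoly_eval_def
proof (intro Pol_sum Pol_cmult)
  fix \<alpha> assume "\<alpha> \<in> Poly_Mapping.keys f"
  with f have vars: "Poly_Mapping.keys \<alpha> \<subseteq> {..<s}"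
    and deg: "(\<Sum>i\<in>Poly_Mapping.keys \<alpha>. Poly_Mapping.lookup \<alpha> i) \<le> t"
    by (auto simp: mpolys_upto_def)
  have "(\<lambda>x. \<Prod>i\<in>Poly_Mapping.keys \<alpha>. \<phi> x $ i ^ Poly_Mapping.lookup \<alpha> i)
      \<in> Pol \<rho> (\<Sum>i\<in>Poly_Mapping.keys \<alpha>. Poly_Mapping.lookup \<alpha> i * r)"
    using vars by (intro Pol_prod Pol_power coordinates) auto
  moreover have "(\<Sum>i\<in>Poly_Mapping.keys \<alpha>. Poly_Mapping.lookup \<alpha> i * r) \<le> t * r"
    using deg by (simp flip: sum_distrib_right)
  ultimately show "(\<lambda>x. \<Prod>i\<in>Poly_Mapping.keys \<alpha>. \<phi> x $ i ^ Poly_Mapping.lookup \<alpha> i)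
      \<in> Pol \<rho> (t * r)"
    using Pol_mono by blast
qed

lemma affine_map_coordinate_in_Pol:
  assumes "affine_map m s \<xi>" "i < s" and carrier: "\<And>x. \<phi> x \<in> carrier_vec m"
    and coordinates: "\<And>j. j < m \<Longrightarrow> (\<lambda>x. \<phi> x $ j) \<in> Pol \<rho> r"
  shows "(\<lambda>x. \<xi> (\<phi> x) $ i) \<in> Pol \<rho> r"
proof -
  obtain A c where A: "A \<in> carrier_mat s m" and c: "c \<in> carrier_vec s"
    and \<xi>: "\<And>v. v \<in> carrier_vec m \<Longrightarrow> \<xi> v = A *\<^sub>v v + c"
    using assms(1) unfolding affine_map_def by blast
  have "\<xi> (\<phi> x) $ i = (\<Sum>j\<in>{0..<m}. A $$ (i, j) * \<phi> x $ j) + c $ i" for x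
    using A c \<open>i < s\<close> carrier[of x] \<xi>[OF carrier] by (simp add: scalar_prod_def)
  moreover have "(\<lambda>x. (\<Sum>j\<in>{0..<m}. A $$ (i, j) * \<phi> x $ j) + c $ i) \<in> Pol \<rho> r"
    by (intro Pol_add Pol_sum Pol_cmult Pol_const coordinates) simp
  ultimately show ?thesis
    by simp
qed

lemma affinely_compatible_coordinate_in_Pol_1:
  assumes "affinely_compatible m \<tau> \<rho>" "j < m"
  shows "(\<lambda>x. \<tau> x $ j) \<in> Pol \<rho> 1"
proof -
  obtain c d where carrier: "\<And>x. \<tau> x \<in> carrier_vec m" and "c \<noteq> 0"
    and \<rho>: "\<And>x y. \<rho> x y = c * (\<tau> x \<bullet> \<tau> y) + d"
    using assms(1) unfolding affinely_compatible_def by blast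
  have "(\<Sum>i\<in>{0..<m}. \<tau> a $ i * \<tau> x $ i) = 1 / c * \<rho> a x + - d / c" for a x
    using carrier[of x] \<open>c \<noteq> 0\<close> by (simp add: \<rho> scalar_prod_def field_simps)
  then have "range (\<lambda>a x. \<Sum>i\<in>{0..<m}. \<tau> a $ i * \<tau> x $ i) \<subseteq> Pol \<rho> 1"
    using affine_separation_in_Pol_1[of "1 / c" \<rho> _ "- d / c"] by auto
  then have "real_fun.span (range (\<lambda>a x. \<Sum>i\<in>{0..<m}. \<tau> a $ i * \<tau> x $ i)) \<subseteq> Pol \<rho> 1"
    by (intro real_fun.span_minimal subspace_Pol)
  then show ?thesis
    using feature_in_span_kernel_sections[of "{0..<m}" j "\<lambda>i x. \<tau> x $ i"] \<open>j < m\<close> by auto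
qed

theorem theorem3p6:
  fixes \<rho> :: "'a \<Rightarrow> 'a \<Rightarrow> real"
    and ip :: "('a \<Rightarrow> real) \<Rightarrow> ('a \<Rightarrow> real) \<Rightarrow> real"
    and n m s t :: nat
    and X :: "'a set" and w :: "'a \<Rightarrow> real"
    and \<tau> :: "'a \<Rightarrow> real vec" and \<xi> :: "real vec \<Rightarrow> real vec"
  assumes "euclidean_polynomial_space \<rho> ip"
    and "polynomial_space_dim \<rho> = n"
    and "weighted_design \<rho> ip t X w"
    and "m \<ge> n"
    and "affinely_compatible m \<tau> \<rho>"
    and "affine_map m s \<xi>"
  shows "\<forall>f \<in> mpolys_upto s t.
           mpoly_eval f \<circ> \<xi> \<circ> \<tau> \<in> Pol \<rho> t \<and>
           ip 1 (mpoly_eval f \<circ> \<xi> \<circ> \<tau>) = (\<Sum>x\<in>X. w x * mpoly_eval f (\<xi> (\<tau> x)))"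
proof
  fix f assume f: "f \<in> mpolys_upto s t"
  have "range \<tau> \<subseteq> carrier_vec m"
    using assms(5) by (simp add: affinely_compatible_def)
  then have "(\<lambda>x. \<xi> (\<tau> x) $ i) \<in> Pol \<rho> 1" if "i < s" for i
    using affinely_compatible_coordinate_in_Pol_1[OF assms(5)] that
    by (intro affine_map_coordinate_in_Pol[OF assms(6)]) auto
  then have "(\<lambda>x. mpoly_eval f (\<xi> (\<tau> x))) \<in> Pol \<rho> (t * 1)"
    by (rule mpoly_eval_in_Pol[OF f])
  then have "mpoly_eval f \<circ> \<xi> \<circ> \<tau> \<in> Pol \<rho> t"
    by (simp add: comp_def)
  then show "mpoly_eval f \<circ> \<xi> \<circ> \<tau> \<in> Pol \<rho> t \<and>
      ip 1 (mpoly_eval f \<circ> \<xi> \<circ> \<tau>) = (\<Sum>x\<in>X. w x * mpoly_eval f (\<xi> (\<tau> x)))"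
    using assms(3) by (simp add: weighted_design_def)
qed

end
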